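(* Let $\mathcal{S}$ be a parameterized system with loop transitions and let $\mathbb{A}$ be a finite set of agent names. Let $\mathcal{N}_0\ldots\mathcal{N}_{N-1}$ be a normalized trap over $\mathbb{A}$ of the instance of $\mathcal{S}$ with $N$ agents. If, for some index $i$ with $0\le i$ and $i+2\le N-1$, we have $\mathcal{N}_i(\mathit{index})=\Box$ and $\mathcal{N}_i=\mathcal{N}_{i+1}=\mathcal{N}_{i+2}$, then for every $k\ge 1$ the word $$\mathcal{N}_0\ldots\mathcal{N}_{i-1}\;\mathcal{N}_i^{\,k}\;\mathcal{N}_{i+1}\ldots\mathcal{N}_{N-1}$$ is a normalized trap over $\mathbb{A}$ of the instance of $\mathcal{S}$ with $N+k-1$ agents.
   Context: **Parameterized systems.** Let $Q$ be a finite set of states and $\mathit{Vars}$ a finite set of variables; each $x\in\mathit{Vars}$ ranges over a finite set $\mathit{Values}_x$. A valuation assigns to each variable $x$ an element of $\mathit{Values}_x$. A parameterized system is a tuple $\mathcal{S}=\langle Q,q_0,\mathit{IVal},\mathbb{T}_{lo},\mathbb{T}_{lp}\rangle$ with an initial state $q_0\in Q$, an initial valuation $\mathit{IVal}$, a finite set $\mathbb{T}_{lo}$ of local transitions and a finite set $\mathbb{T}_{lp}$ of loop transitions. A local transition has the form $\langle \mathit{origin},\langle x_1:=v_1,\ldots,x_r:=v_r\rangle,\mathit{target}\rangle$ with $\mathit{origin},\mathit{target}\in Q$, distinct variables $x_1,\ldots,x_r$ and $v_h\in\mathit{Values}_{x_h}$. A loop transition has the form $\langle\mathit{origin},\varphi,\mathit{target}_{succ},\mathit{target}_{fail}\rangle$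 with $\mathit{origin},\mathit{target}_{succ},\mathit{target}_{fail}\in Q$ and $\varphi$ a Boolean combination of atoms $x=v$ ($x\in\mathit{Vars}$, $v\in\mathit{Values}_x$) and the predicate $\mathit{self}$. **Slotted words.** For a finite set of slots, each slot $s$ having a finite alphabet $\Sigma_s$, a slotted word is a finite word over $\prod_s\Sigma_s$; for a letter $a$, $a(s)\in\Sigma_s$ denotes its component at slot $s$. **Configurations.** For $N>0$, the instance of $\mathcal{S}$ with $N$ agents (indexed $0,\ldots,N-1$) has the slots $\mathit{loc}$, all $x\in\mathit{Vars}$, and $i.t$ for all $0\le i<N$, $t\in\mathbb{T}_{lp}$, with alphabets $\Sigma_{\mathit{loc}}=Q\cup\mathbb{T}_{lp}$ (disjoint union), $\Sigma_x=\mathit{Values}_x$, $\Sigma_{i.t}=\{\uparrow,\Box\}$. A configuration is a slotted word $c=c_0\ldots c_{N-1}$ over these slots such that for all $i$ and $t\in\mathbb{T}_{lp}$: if $c_i(\mathit{loc})=t$ then there is exactly one $j$ with $c_j(i.t)=\uparrow$; and if $c_i(\mathit{loc})\ne t$ then $c_j(i.t)=\Box$ for all $j$. (So $c_j(i.t)=\uparrow$ means agent $i$ is executing $t$ and inspects agent $j$ next.) The initial configuration $C_0$ has, for every agent, $\mathit{loc}=q_0$, every variable $x$ equal to $\mathit{IVal}(x)$, and all slots $i.t$ equal to $\Box$. **Step relation $\vdash$** on configurations of the instance with $N$ agents. $c\vdash c'$ holds iff $c'$ arises from $c$ in one of the following ways for some agent $i$ (all components not mentioned are unchanged): - (local) for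 a local transition $\langle \mathit{origin},\langle x_1:=v_1,\ldots,x_r:=v_r\rangle,\mathit{target}\rangle\in\mathbb{T}_{lo}$ with $c_i(\mathit{loc})=\mathit{origin}$: set $c'_i(x_h)=v_h$ for all $h$, and $c'_i(\mathit{loc})=\mathit{target}$; - (loop start) for a loop transition $t=\langle\mathit{origin},\varphi,\mathit{target}_{succ},\mathit{target}_{fail}\rangle\in\mathbb{T}_{lp}$ with $c_i(\mathit{loc})=\mathit{origin}$: set $c'_i(\mathit{loc})=t$ and $c'_0(i.t)=\uparrow$; - (loop step) for a loop transition $t=\langle\mathit{origin},\varphi,\mathit{target}_{succ},\mathit{target}_{fail}\rangle\in\mathbb{T}_{lp}$ with $c_i(\mathit{loc})=t$, let $j$ be the unique index with $c_j(i.t)=\uparrow$, and evaluate $\varphi$ on the variable values of $c_j$, with $\mathit{self}$ true iff $j=i$. If $\varphi$ holds and $j=N-1$: set $c'_i(\mathit{loc})=\mathit{target}_{succ}$ and $c'_j(i.t)=\Box$. If $\varphi$ holds and $j<N-1$: set $c'_j(i.t)=\Box$ and $c'_{j+1}(i.t)=\uparrow$. If $\varphi$ does not hold: set $c'_i(\mathit{loc})=\mathit{target}_{fail}$ and $c'_j(i.t)=\Box$. **Traps.** A powerword of the instance with $N$ agents is a slotted word $O=O_0\ldots O_{N-1}$ over the same slots but with alphabets $2^{\Sigma_s}$. A configuration $C=c_0\ldots c_{N-1}$ intersects $O$, written $C\sqcap O$, if there are an index $j$ and a slot $s$ with $c_j(s)\in O_j(s)$. A powerword $O$ is a trap of the instance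 if $C_0\sqcap O$ and for all configurations $C,C'$ of the instance: $C\vdash C'$ and $C\sqcap O$ imply $C'\sqcap O$. **Normalized traps.** Let $\mathbb{A}=\{p_0,\ldots,p_{m-1}\}$ be a finite set of agent names. A normalized trap over $\mathbb{A}$ of the instance with $N$ agents is a slotted word $\mathcal{N}_0\ldots\mathcal{N}_{N-1}$ over the slots $\mathit{index}$, $\mathit{loc}$, all $x\in\mathit{Vars}$, and $p.t$ for $p\in\mathbb{A}$, $t\in\mathbb{T}_{lp}$, where the alphabet of $\mathit{index}$ is $\mathbb{A}\cup\{\Box\}$, the alphabets of $\mathit{loc}$ and $x$ are $2^{Q\cup\mathbb{T}_{lp}}$ and $2^{\mathit{Values}_x}$, and the alphabet of $p.t$ is $2^{\{\uparrow,\Box\}}$, such that: - for every $p\in\mathbb{A}$ there is exactly one $j$ with $\mathcal{N}_j(\mathit{index})=p$ ($p$ is then the name of agent $j$); - for every $p\in\mathbb{A}$ and every $t\in\mathbb{T}_{lp}$ there is at least one $k$ with $\mathcal{N}_k(p.t)=\{\uparrow\}$; - the powerword $O$ associated with it is a trap of the instance, where $O_j(s)=\mathcal{N}_j(s)$ for $s\in\{\mathit{loc}\}\cup\mathit{Vars}$, $O_j(i.t)=\mathcal{N}_j(p.t)$ if agent $i$ has name $p$, and $O_j(i.t)=\emptyset$ if $\mathcal{N}_i(\mathit{index})=\Box$. *)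

theory Defs
  imports Main "HOL-Library.FuncSet"
begin

text \<open>
  Parameterized systems. A Boolean constant is not needed as a separate constructor of guards:
  it is expressible with \<open>Self\<close>, negation and disjunction.
\<close>

datatype ('x, 'v) guard =
    Eq 'x 'v
  | Self
  | Neg "('x, 'v) guard"
  | Conj "('x, 'v) guard" "('x, 'v) guard"
  | Disj "('x, 'v) guard" "('x, 'v) guard"

primrec guard_atoms :: "('x, 'v) guard \<Rightarrow> ('x \<times> 'v) set" where
  "guard_atoms (Eq x v) = {(x, v)}"
| "guard_atoms Self = {}"
| "guard_atoms (Neg g) = guard_atoms g"
| "guard_atoms (Conj g h) = guard_atoms g \<union> guard_atoms h"
| "guard_atoms (Disj g h) = guard_atoms g \<union> guard_atoms h"

datatype ('q, 'x, 'v) local_trans =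
  LocalTrans (lt_origin: 'q) (lt_assigns: "('x \<times> 'v) list") (lt_target: 'q)

datatype ('q, 'x, 'v) loop_trans =
  LoopTrans (origin: 'q) (guard: "('x, 'v) guard") (target_succ: 'q) (target_fail: 'q)

record ('q, 'x, 'v) system =
  states :: "'q set"
  vars :: "'x set"
  vals :: "'x \<Rightarrow> 'v set"
  init_state :: 'q
  init_val :: "'x \<Rightarrow> 'v"
  local_transitions :: "('q, 'x, 'v) local_trans set"
  loop_transitions :: "('q, 'x, 'v) loop_trans set"

definition wf_local_trans :: "('q, 'x, 'v) system \<Rightarrow> ('q, 'x, 'v) local_trans \<Rightarrow> bool" where
  "wf_local_trans S \<tau> \<longleftrightarrow>
     lt_origin \<tau> \<in> states S \<and> lt_target \<tau> \<in> states S \<and>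
     distinct (map fst (lt_assigns \<tau>)) \<and>
     (\<forall>(x, v) \<in> set (lt_assigns \<tau>). x \<in> vars S \<and> v \<in> vals S x)"

definition wf_loop_trans :: "('q, 'x, 'v) system \<Rightarrow> ('q, 'x, 'v) loop_trans \<Rightarrow> bool" where
  "wf_loop_trans S t \<longleftrightarrow>
     origin t \<in> states S \<and> target_succ t \<in> states S \<and> target_fail t \<in> states S \<and>
     (\<forall>(x, v) \<in> guard_atoms (guard t). x \<in> vars S \<and> v \<in> vals S x)"

definition parameterized_system :: "('q, 'x, 'v) system \<Rightarrow> bool" where
  "parameterized_system S \<longleftrightarrow>
     finite (states S) \<and> finite (vars S) \<and> (\<forall>x \<in> vars S. finite (vals S x)) \<and>
     init_state S \<in> states S \<and>
     init_val S \<in> (\<Pi>\<^sub>E x \<in> vars S. vals S x) \<and>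
     finite (local_transitions S) \<and> (\<forall>\<tau> \<in> local_transitions S. wf_local_trans S \<tau>) \<and>
     finite (loop_transitions S) \<and> (\<forall>t \<in> loop_transitions S. wf_loop_trans S t)"

text \<open>
  A letter over a set of slots is an extensional function (\<open>undefined\<close> off the slots), so that
  equality of letters is equality of their components.
\<close>

definition slotted_words :: "'s set \<Rightarrow> ('s \<Rightarrow> 'a set) \<Rightarrow> nat \<Rightarrow> ('s \<Rightarrow> 'a) list set" where
  "slotted_words Sl \<Sigma> N = {w. length w = N \<and> set w \<subseteq> (\<Pi>\<^sub>E s \<in> Sl. \<Sigma> s)}"

text \<open>
  \<open>Ptr n t\<close> is the slot written \<open>n.t\<close>; \<open>n\<close> is an agent index (a number) in configurations and
  powerwords, and an agent name in normalized traps. The alphabets of all slots live in one type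
  of symbols; \<open>St\<close> and \<open>Lp\<close> make the union of states and loop transitions disjoint.
\<close>

datatype ('n, 'q, 'x, 'v) slot =
    Loc
  | Var 'x
  | Ptr 'n "('q, 'x, 'v) loop_trans"

datatype ('q, 'x, 'v) symbol =
    St 'q
  | Lp "('q, 'x, 'v) loop_trans"
  | Val 'v
  | Up
  | Box

definition slots :: "('q, 'x, 'v) system \<Rightarrow> 'n set \<Rightarrow> ('n, 'q, 'x, 'v) slot set" where
  "slots S I = {Loc} \<union> Var ` vars S \<union> {Ptr n t | n t. n \<in> I \<and> t \<in> loop_transitions S}"

primrec alphabet :: "('q, 'x, 'v) system \<Rightarrow> ('n, 'q, 'x, 'v) slot \<Rightarrow> ('q, 'x, 'v) symbol set" where
  "alphabet S Loc = St ` states S \<union> Lp ` loop_transitions S"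
| "alphabet S (Var x) = Val ` vals S x"
| "alphabet S (Ptr n t) = {Up, Box}"

type_synonym ('q, 'x, 'v) letter = "(nat, 'q, 'x, 'v) slot \<Rightarrow> ('q, 'x, 'v) symbol"
type_synonym ('q, 'x, 'v) power_letter = "(nat, 'q, 'x, 'v) slot \<Rightarrow> ('q, 'x, 'v) symbol set"

definition configuration :: "('q, 'x, 'v) system \<Rightarrow> nat \<Rightarrow> ('q, 'x, 'v) letter list \<Rightarrow> bool" where
  "configuration S N c \<longleftrightarrow>
     c \<in> slotted_words (slots S {..<N}) (alphabet S) N \<and>
     (\<forall>i < N. \<forall>t \<in> loop_transitions S.
        ((c ! i) Loc = Lp t \<longrightarrow> (\<exists>!j. j < N \<and> (c ! j) (Ptr i t) = Up)) \<and>
        ((c ! i) Loc \<noteq> Lp t \<longrightarrow> (\<forall>j < N. (c ! j) (Ptr i t) = Box)))"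

definition init_config :: "('q, 'x, 'v) system \<Rightarrow> nat \<Rightarrow> ('q, 'x, 'v) letter list" where
  "init_config S N = replicate N
     (\<lambda>s \<in> slots S {..<N}. case s of
        Loc \<Rightarrow> St (init_state S)
      | Var x \<Rightarrow> Val (init_val S x)
      | Ptr i t \<Rightarrow> Box)"

primrec holds :: "('x, 'v) guard \<Rightarrow> ('q, 'x, 'v) letter \<Rightarrow> bool \<Rightarrow> bool" where
  "holds (Eq x v) l self \<longleftrightarrow> l (Var x) = Val v"
| "holds Self l self \<longleftrightarrow> self"
| "holds (Neg g) l self \<longleftrightarrow> \<not> holds g l self"
| "holds (Conj g h) l self \<longleftrightarrow> holds g l self \<and> holds h l self"
| "holds (Disj g h) l self \<longleftrightarrow> holds g l self \<or> holds h l self"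

definition set_slot :: "nat \<Rightarrow> 's \<Rightarrow> 'a \<Rightarrow> ('s \<Rightarrow> 'a) list \<Rightarrow> ('s \<Rightarrow> 'a) list" where
  "set_slot i s a c = c[i := (c ! i)(s := a)]"

text \<open>
  The relation is meant to be used on configurations only; there the index \<open>j\<close> in the loop steps
  is uniquely determined by \<open>i\<close> and \<open>t\<close>.
\<close>

inductive step ::
  "('q, 'x, 'v) system \<Rightarrow> nat \<Rightarrow> ('q, 'x, 'v) letter list \<Rightarrow> ('q, 'x, 'v) letter list \<Rightarrow> bool"
  for S N c where
  local_step:
    "\<lbrakk>i < N; \<tau> \<in> local_transitions S; (c ! i) Loc = St (lt_origin \<tau>)\<rbrakk> \<Longrightarrow>
     step S N c
       (set_slot i Loc (St (lt_target \<tau>))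
         (fold (\<lambda>(x, v). set_slot i (Var x) (Val v)) (lt_assigns \<tau>) c))"
| loop_start:
    "\<lbrakk>i < N; t \<in> loop_transitions S; (c ! i) Loc = St (origin t)\<rbrakk> \<Longrightarrow>
     step S N c (set_slot 0 (Ptr i t) Up (set_slot i Loc (Lp t) c))"
| loop_succ:
    "\<lbrakk>i < N; t \<in> loop_transitions S; (c ! i) Loc = Lp t;
      j < N; (c ! j) (Ptr i t) = Up; holds (guard t) (c ! j) (j = i); j = N - 1\<rbrakk> \<Longrightarrow>
     step S N c (set_slot j (Ptr i t) Box (set_slot i Loc (St (target_succ t)) c))"
| loop_next:
    "\<lbrakk>i < N; t \<in> loop_transitions S; (c ! i) Loc = Lp t;
      j < N; (c ! j) (Ptr i t) = Up; holds (guard t) (c ! j) (j = i); j < N - 1\<rbrakk> \<Longrightarrow>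
     step S N c (set_slot (j + 1) (Ptr i t) Up (set_slot j (Ptr i t) Box c))"
| loop_fail:
    "\<lbrakk>i < N; t \<in> loop_transitions S; (c ! i) Loc = Lp t;
      j < N; (c ! j) (Ptr i t) = Up; \<not> holds (guard t) (c ! j) (j = i)\<rbrakk> \<Longrightarrow>
     step S N c (set_slot j (Ptr i t) Box (set_slot i Loc (St (target_fail t)) c))"

definition powerword :: "('q, 'x, 'v) system \<Rightarrow> nat \<Rightarrow> ('q, 'x, 'v) power_letter list \<Rightarrow> bool" where
  "powerword S N P \<longleftrightarrow> P \<in> slotted_words (slots S {..<N}) (\<lambda>s. Pow (alphabet S s)) N"

definition intersects ::
  "('q, 'x, 'v) system \<Rightarrow> nat \<Rightarrow> ('q, 'x, 'v) letter list \<Rightarrow> ('q, 'x, 'v) power_letter list \<Rightarrow> bool"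
  where
  "intersects S N c P \<longleftrightarrow> (\<exists>j < N. \<exists>s \<in> slots S {..<N}. (c ! j) s \<in> (P ! j) s)"

text \<open>
  No separate assumption \<open>0 < N\<close> is made: there are no traps for \<open>N = 0\<close>, since nothing intersects
  the empty powerword.
\<close>

definition trap :: "('q, 'x, 'v) system \<Rightarrow> nat \<Rightarrow> ('q, 'x, 'v) power_letter list \<Rightarrow> bool" where
  "trap S N P \<longleftrightarrow>
     powerword S N P \<and>
     intersects S N (init_config S N) P \<and>
     (\<forall>c c'. configuration S N c \<longrightarrow> configuration S N c' \<longrightarrow>
        step S N c c' \<longrightarrow> intersects S N c P \<longrightarrow> intersects S N c' P)"

text \<open>
  A letter of a normalized trap has the slot \<open>index\<close>, whose blank symbol is \<open>None\<close>, and a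
  component \<open>comp\<close> for the remaining slots, all of which have set-valued alphabets.
\<close>

record ('p, 'q, 'x, 'v) norm_letter =
  index :: "'p option"
  comp :: "('p, 'q, 'x, 'v) slot \<Rightarrow> ('q, 'x, 'v) symbol set"

definition associated_powerword ::
  "('q, 'x, 'v) system \<Rightarrow> nat \<Rightarrow> ('p, 'q, 'x, 'v) norm_letter list \<Rightarrow> ('q, 'x, 'v) power_letter list"
  where
  "associated_powerword S N w = map
     (\<lambda>l. \<lambda>s \<in> slots S {..<N}. case s of
        Loc \<Rightarrow> comp l Loc
      | Var x \<Rightarrow> comp l (Var x)
      | Ptr i t \<Rightarrow> (case index (w ! i) of Some p \<Rightarrow> comp l (Ptr p t) | None \<Rightarrow> {})) w"

definition normalized_trap ::
  "('q, 'x, 'v) system \<Rightarrow> 'p set \<Rightarrow> nat \<Rightarrow> ('p, 'q, 'x, 'v) norm_letter list \<Rightarrow> bool" where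
  "normalized_trap S A N w \<longleftrightarrow>
     length w = N \<and>
     (\<forall>l \<in> set w. index l \<in> Some ` A \<union> {None}) \<and>
     map comp w \<in> slotted_words (slots S A) (\<lambda>s. Pow (alphabet S s)) N \<and>
     (\<forall>p \<in> A. \<exists>!j. j < N \<and> index (w ! j) = Some p) \<and>
     (\<forall>p \<in> A. \<forall>t \<in> loop_transitions S. \<exists>k < N. comp (w ! k) (Ptr p t) = {Up}) \<and>
     trap S N (associated_powerword S N w)"

end

theory Submission
  imports Defs
begin

text \<open>
  It suffices to insert one copy of the repeated letter at a time, so that the enlarged instance
  has a block of four equal nameless letters. Suppose some step \<open>c \<turnstile> c'\<close> of the enlarged instance
  loses the intersection. The step touches at most three agents: the moving one and the old and
  new positions of its pointer. So some agent \<open>d\<close> of the block is untouched, and removing it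
  projects the step to the original instance. Pointers of other agents at \<open>d\<close> are redirected to
  another agent \<open>e\<close> of the block, which creates no intersection with \<open>c'\<close> because the trap has the
  same letter at \<open>d\<close> and at \<open>e\<close>; the intersection with \<open>c\<close> survives because it is at a slot changed
  by the step. Hence the original powerword would not be a trap.
\<close>

section \<open>Renumbering agents and slots around an omitted index\<close>

definition skip :: "nat \<Rightarrow> nat \<Rightarrow> nat" where
  "skip d n = (if n < d then n else Suc n)"

text \<open>\<open>skip d\<close> is the increasing injection whose range omits exactly
  \<open>d\<close>. Only pointer slots mention an agent, so only they are renumbered. The slots
  \<open>Ptr d t\<close> are outside the image: the pointers owned by \<open>d\<close> disappear
  together with \<open>d\<close>.\<close>

primrec skip_slot :: "nat \<Rightarrow> (nat, 'q, 'x, 'v) slot \<Rightarrow> (nat, 'q, 'x, 'v) slot" where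
  "skip_slot d Loc = Loc"
| "skip_slot d (Var x) = Var x"
| "skip_slot d (Ptr i t) = Ptr (skip d i) t"

lemma skip_neq: "skip d n \<noteq> d"
  by (simp add: skip_def)

lemma skip_eq_iff [simp]: "skip d m = skip d n \<longleftrightarrow> m = n"
  by (auto simp: skip_def split: if_splits)

lemma skip_less_Suc: "n < N \<Longrightarrow> skip d n < Suc N"
  by (simp add: skip_def)

lemma skip_Suc: "Suc (skip d n) \<noteq> d \<Longrightarrow> skip d (Suc n) = Suc (skip d n)"
  by (auto simp: skip_def split: if_splits)

lemma ex_skip:
  assumes "j < Suc N" "d < Suc N" "j \<noteq> d"
  obtains n where "n < N" "j = skip d n"
proof (cases "j < d")
  case True
  then show thesis using assms by (intro that[of j]) (auto simp: skip_def)
next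
  case False
  then show thesis using assms by (intro that[of "j - 1"]) (auto simp: skip_def)
qed

lemma skip_slot_eq_iff [simp]: "skip_slot d r = skip_slot d s \<longleftrightarrow> r = s"
  by (cases r; cases s) auto

lemma skip_slot_in_slots: "s \<in> slots S {..<N} \<Longrightarrow> skip_slot d s \<in> slots S {..<Suc N}"
  by (cases s) (auto simp: slots_def skip_less_Suc)

lemma in_slots_simps [simp]:
  "Loc \<in> slots S I"
  "Var x \<in> slots S I \<longleftrightarrow> x \<in> vars S"
  "Ptr n t \<in> slots S I \<longleftrightarrow> n \<in> I \<and> t \<in> loop_transitions S"
  by (auto simp: slots_def)

lemma alphabet_skip_slot [simp]: "alphabet S (skip_slot d s) = alphabet S s"
  by (cases s) auto

section \<open>Updating single components and removing an agent\<close>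

lemma set_slot_nth:
  "i < length c \<Longrightarrow> (set_slot i s a c ! j) r = (if j = i \<and> r = s then a else (c ! j) r)"
  by (auto simp: set_slot_def nth_list_update)

lemma length_set_slot [simp]: "length (set_slot i s a c) = length c"
  by (simp add: set_slot_def)

lemma length_fold_set_slot [simp]:
  "length (fold (\<lambda>(x, v). set_slot i (Var x) (Val v)) xs c) = length c"
  by (induction xs arbitrary: c) auto

lemma fold_set_slot_nth:
  assumes "i < length c" and "j \<noteq> i \<or> s \<notin> Var ` fst ` set xs"
  shows "(fold (\<lambda>(x, v). set_slot i (Var x) (Val v)) xs c ! j) s = (c ! j) s"
  using assms by (induction xs arbitrary: c) (auto simp: set_slot_nth)

text \<open>Agent \<open>d\<close> is dropped, and a pointer that rests on \<open>d\<close> is moved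
  to agent \<open>e\<close>, where \<open>e\<close> is counted in the smaller instance. The test for
  \<open>Up\<close> need not ask for the kind of slot: in a configuration only pointer slots can
  carry \<open>Up\<close>.\<close>

definition remove_agent ::
  "('q, 'x, 'v) system \<Rightarrow> nat \<Rightarrow> nat \<Rightarrow> nat \<Rightarrow> ('q, 'x, 'v) letter list \<Rightarrow> ('q, 'x, 'v) letter list"
  where
  "remove_agent S N d e c = map
     (\<lambda>n. \<lambda>s \<in> slots S {..<N}.
        if n = e \<and> (c ! d) (skip_slot d s) = Up then Up else (c ! skip d n) (skip_slot d s)) [0..<N]"

lemma length_remove_agent [simp]: "length (remove_agent S N d e c) = N"
  by (simp add: remove_agent_def)

lemma remove_agent_nth:
  "n < N \<Longrightarrow> s \<in> slots S {..<N} \<Longrightarrow>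
   (remove_agent S N d e c ! n) s =
     (if n = e \<and> (c ! d) (skip_slot d s) = Up then Up else (c ! skip d n) (skip_slot d s))"
  by (simp add: remove_agent_def)

text \<open>Removal commutes with a write outside \<open>d\<close>. If \<open>d\<close> carried
  \<open>Up\<close> in the written slot and \<open>n = e\<close>, the redirected pointer would mask
  the new value; the last hypothesis excludes this.\<close>

lemma remove_agent_set_slot:
  assumes "length c = Suc N" "n < N" "s \<in> slots S {..<N}" "(c ! d) (skip_slot d s) \<noteq> Up"
  shows "remove_agent S N d e (set_slot (skip d n) (skip_slot d s) a c)
       = set_slot n s a (remove_agent S N d e c)"
proof (rule nth_equalityI, goal_cases)
  case (2 m)
  then have m: "m < N" by simp
  show ?case
  proof
    fix r
    show "(remove_agent S N d e (set_slot (skip d n) (skip_slot d s) a c) ! m) r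
        = (set_slot n s a (remove_agent S N d e c) ! m) r"
    proof (cases "r \<in> slots S {..<N}")
      case True
      then show ?thesis
        using assms m skip_neq[of d n] skip_less_Suc[of n N d]
        by (auto simp: remove_agent_nth set_slot_nth)
    next
      case False
      \<comment> \<open>Off the slots, removal yields \<open>undefined\<close> on both sides, and
        the write concerns a genuine slot.\<close>
      with assms(3) have "r \<noteq> s" by blast
      with False show ?thesis
        using assms m by (simp add: set_slot_nth) (simp add: remove_agent_def)
    qed
  qed
qed simp

lemma remove_agent_fold_set_slot:
  assumes "length c = Suc N" "n < N"
    and "\<forall>(x, v) \<in> set xs. x \<in> vars S" "\<forall>x \<in> vars S. (c ! d) (Var x) \<noteq> Up"
  shows "remove_agent S N d e (fold (\<lambda>(x, v). set_slot (skip d n) (Var x) (Val v)) xs c)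
       = fold (\<lambda>(x, v). set_slot n (Var x) (Val v)) xs (remove_agent S N d e c)"
  using assms
proof (induction xs arbitrary: c)
  case (Cons y ys)
  obtain x v where y: "y = (x, v)" by fastforce
  let ?c = "set_slot (skip d n) (Var x) (Val v) c"
  have "remove_agent S N d e ?c = set_slot n (Var x) (Val v) (remove_agent S N d e c)"
    using Cons.prems y remove_agent_set_slot[of c N n "Var x" S d e "Val v"] by auto
  moreover have "\<forall>x \<in> vars S. (?c ! d) (Var x) \<noteq> Up"
    using Cons.prems skip_less_Suc[of n N d] by (simp add: set_slot_nth)
  ultimately show ?case
    using Cons.IH[of ?c] Cons.prems y by simp
qed simp

section \<open>Configurations and their stability under removal\<close>

lemma configuration_length: "configuration S N c \<Longrightarrow> length c = N"
  by (simp add: configuration_def slotted_words_def)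

lemma configuration_in_alphabet:
  assumes "configuration S N c" "j < N" "s \<in> slots S {..<N}"
  shows "(c ! j) s \<in> alphabet S s"
proof -
  have "c ! j \<in> (\<Pi>\<^sub>E s \<in> slots S {..<N}. alphabet S s)"
    using assms(1,2) nth_mem[of j c] unfolding configuration_def slotted_words_def by blast
  then show ?thesis using assms(3) by (rule PiE_mem)
qed

lemma configuration_not_Up:
  assumes "configuration S N c" "j < N"
  shows "(c ! j) Loc \<noteq> Up" and "x \<in> vars S \<Longrightarrow> (c ! j) (Var x) \<noteq> Up"
  using configuration_in_alphabet[OF assms, of Loc] configuration_in_alphabet[OF assms, of "Var x"]
  by auto

lemma configuration_Up_unique:
  assumes "configuration S N c" "i < N" "t \<in> loop_transitions S"
    and "j < N" "(c ! j) (Ptr i t) = Up" "j' < N" "(c ! j') (Ptr i t) = Up"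
  shows "j = j'"
  using assms unfolding configuration_def by (metis symbol.distinct(19))

lemma configuration_not_executing:
  assumes "configuration S N c" "i < N" "t \<in> loop_transitions S" "(c ! i) Loc \<noteq> Lp t" "j < N"
  shows "(c ! j) (Ptr i t) = Box"
  using assms unfolding configuration_def by blast

text \<open>A running agent still has exactly one pointer: a unique \<open>Up\<close> at
  \<open>d\<close> reappears at \<open>e\<close>, and any other one stays with its renumbered agent.
  The \<open>Loc\<close> components are kept, so an agent that does not execute \<open>t\<close>
  still has only \<open>Box\<close>.\<close>

lemma configuration_remove_agent:
  assumes c: "configuration S (Suc N) c" and d: "d < Suc N" and e: "e < N"
  shows "configuration S N (remove_agent S N d e c)"
  unfolding configuration_def
proof (intro conjI allI ballI impI)
  let ?D = "remove_agent S N d e c"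
  have "(?D ! n) s \<in> alphabet S s" if n: "n < N" and s: "s \<in> slots S {..<N}" for n s
    using configuration_in_alphabet[OF c d, of "skip_slot d s"]
      configuration_in_alphabet[OF c, of "skip d n" "skip_slot d s"] n s
    by (auto simp: remove_agent_nth skip_slot_in_slots skip_less_Suc)
  moreover have "?D ! n \<in> extensional (slots S {..<N})" if "n < N" for n
    using that by (simp add: remove_agent_def)
  ultimately show "?D \<in> slotted_words (slots S {..<N}) (alphabet S) N"
    by (auto simp: slotted_words_def in_set_conv_nth intro!: PiE_I simp: extensional_def)
next
  let ?D = "remove_agent S N d e c"
  fix i t assume i: "i < N" and t: "t \<in> loop_transitions S"
  have s: "Ptr i t \<in> slots S {..<N}" using i t by simp
  have i': "skip d i < Suc N" using i by (rule skip_less_Suc)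
  have loc: "(?D ! i) Loc = (c ! skip d i) Loc"
    using i configuration_not_Up(1)[OF c d] by (simp add: remove_agent_nth)
  {
    assume "(?D ! i) Loc = Lp t"
    then obtain j where j: "j < Suc N" "(c ! j) (Ptr (skip d i) t) = Up"
      using c i' t loc unfolding configuration_def by metis
    have uniq: "(c ! j') (Ptr (skip d i) t) = Up \<longleftrightarrow> j' = j" if "j' < Suc N" for j'
      using configuration_Up_unique[OF c i' t] j that by blast
    show "\<exists>!n. n < N \<and> (?D ! n) (Ptr i t) = Up"
    proof (cases "j = d")
      case True
      then have "(?D ! n) (Ptr i t) = Up \<longleftrightarrow> n = e" if "n < N" for n
        using that s d uniq skip_less_Suc[OF that] skip_neq[of d n]
        by (auto simp: remove_agent_nth)
      then show ?thesis using e by blast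
    next
      case False
      obtain m where m: "m < N" "j = skip d m" using ex_skip[OF j(1) d False] .
      have "(?D ! n) (Ptr i t) = Up \<longleftrightarrow> n = m" if "n < N" for n
        using that s uniq[OF d] uniq[OF skip_less_Suc[OF that]] False m
        by (auto simp: remove_agent_nth)
      then show ?thesis using m by blast
    qed
  next
    fix n assume *: "(?D ! i) Loc \<noteq> Lp t" and n: "n < N"
    have "(c ! j) (Ptr (skip d i) t) = Box" if "j < Suc N" for j
      using configuration_not_executing[OF c i' t _ that] * loc by simp
    then show "(?D ! n) (Ptr i t) = Box"
      using n s d skip_less_Suc[OF n] by (simp add: remove_agent_nth)
  }
qed

section \<open>Projecting guards and steps to the smaller instance\<close>

lemma holds_cong:
  assumes "\<forall>(x, v) \<in> guard_atoms g. l (Var x) = l' (Var x)"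
  shows "holds g l b = holds g l' b"
  using assms by (induction g) auto

text \<open>Guards of a well-formed system read declared variables only, and these never carry
  \<open>Up\<close>, so redirection cannot alter them. The truth value of \<open>Self\<close> is
  also kept when a step is projected, because \<open>skip d\<close> is injective.\<close>

lemma holds_remove_agent:
  assumes "parameterized_system S" "configuration S (Suc N) c" "d < Suc N"
    and "n < N" "t \<in> loop_transitions S"
  shows "holds (guard t) (remove_agent S N d e c ! n) b = holds (guard t) (c ! skip d n) b"
proof (rule holds_cong)
  have "x \<in> vars S" if "(x, v) \<in> guard_atoms (guard t)" for x v
    using assms(1,5) that by (fastforce simp: parameterized_system_def wf_loop_trans_def)
  then show "\<forall>(x, v) \<in> guard_atoms (guard t).
      (remove_agent S N d e c ! n) (Var x) = (c ! skip d n) (Var x)"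
    using assms(4) configuration_not_Up(2)[OF assms(2,3)] by (auto simp: remove_agent_nth)
qed

text \<open>The second clause makes every changed component visible after the removal: it is not at
  \<open>d\<close>, its slot survives, and no pointer is redirected in that slot. Hence its old
  value in \<open>c\<close> can be read off \<open>remove_agent S N d e c\<close>. The agent
  \<open>e\<close> is left open because it is chosen only once \<open>d\<close> is known.\<close>

definition projects ::
  "('q, 'x, 'v) system \<Rightarrow> nat \<Rightarrow> nat \<Rightarrow> ('q, 'x, 'v) letter list \<Rightarrow> ('q, 'x, 'v) letter list \<Rightarrow> bool"
  where
  "projects S N d c c' \<longleftrightarrow>
     (\<forall>e < N. step S N (remove_agent S N d e c) (remove_agent S N d e c')) \<and>
     (\<forall>j < Suc N. \<forall>s \<in> slots S {..<Suc N}. (c' ! j) s \<noteq> (c ! j) s \<longrightarrow>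
        j \<noteq> d \<and> s \<in> skip_slot d ` slots S {..<N} \<and> (c ! d) s \<noteq> Up)"

lemma projectsI:
  assumes "\<And>e. e < N \<Longrightarrow> step S N (remove_agent S N d e c) (remove_agent S N d e c')"
    and "\<And>j s. s \<in> slots S {..<Suc N} \<Longrightarrow> (c' ! j) s \<noteq> (c ! j) s \<Longrightarrow>
        j \<noteq> d \<and> s \<in> skip_slot d ` slots S {..<N} \<and> (c ! d) s \<noteq> Up"
  shows "projects S N d c c'"
  unfolding projects_def using assms by blast

text \<open>\<open>F\<close> consists of the moving agent and the positions where its pointer is
  removed or placed; \<open>loop_next\<close> accounts for the bound 3. For \<open>d\<close> outside
  \<open>F\<close> all these indices lie in the range of \<open>skip d\<close>, so the same rule
  fires at their preimages.\<close>

lemma step_projects: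
  assumes S: "parameterized_system S" and c: "configuration S (Suc N) c"
    and step: "step S (Suc N) c c'"
  obtains F where "finite F" "card F \<le> 3"
    "\<And>d. d < Suc N \<Longrightarrow> d \<notin> F \<Longrightarrow> projects S N d c c'"
proof -
  have len: "length c = Suc N" using c by (rule configuration_length)
  have LocI: "Loc \<in> skip_slot d ` slots S {..<N}" for d
    by (rule image_eqI[of _ _ Loc]) simp_all
  have VarI: "Var x \<in> skip_slot d ` slots S {..<N}" if "x \<in> vars S" for x d
    by (rule image_eqI[of _ _ "Var x"]) (simp_all add: that)
  have PtrI: "Ptr (skip d n) t \<in> skip_slot d ` slots S {..<N}"
    if "n < N" "t \<in> loop_transitions S" for d n t
    by (rule image_eqI[of _ _ "Ptr n t"]) (simp_all add: that)
  note rm = remove_agent_set_slot[where s = Loc, simplified]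
    remove_agent_set_slot[where s = "Ptr i t" for i t, simplified]
  have card3: "card {a, b, b'} \<le> 3" for a b b' :: nat
    by (simp add: card_insert_if)
  from step show thesis
  proof cases
    case (local_step i \<tau>)
    have xs: "\<forall>(x, v) \<in> set (lt_assigns \<tau>). x \<in> vars S"
      using S local_step(3) by (fastforce simp: parameterized_system_def wf_local_trans_def)
    show thesis
    proof (rule that[of "{i}"])
      fix d assume d: "d < Suc N" "d \<notin> {i}"
      obtain n where n: "n < N" "i = skip d n" using ex_skip[OF local_step(2) d(1)] d(2) by auto
      note nU = configuration_not_Up[OF c d(1)]
      let ?f = "fold (\<lambda>(x, v). set_slot i (Var x) (Val v)) (lt_assigns \<tau>) c"
      have fLoc: "(?f ! d) Loc = (c ! d) Loc"
        using fold_set_slot_nth[of i c d Loc "lt_assigns \<tau>"] local_step(2) len d(2) by auto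
      show "projects S N d c c'"
      proof (rule projectsI)
        fix e assume "e < N"
        have "remove_agent S N d e c' = set_slot n Loc (St (lt_target \<tau>))
          (fold (\<lambda>(x, v). set_slot n (Var x) (Val v)) (lt_assigns \<tau>) (remove_agent S N d e c))"
          unfolding local_step(1)
          using rm(1)[of ?f N n d S e] remove_agent_fold_set_slot[OF len n(1) xs, of d e]
            n nU fLoc len by simp
        then show "step S N (remove_agent S N d e c) (remove_agent S N d e c')"
          using step.local_step[of n N \<tau> S "remove_agent S N d e c"] n local_step nU
          by (simp add: remove_agent_nth)
      next
        fix j s assume "(c' ! j) s \<noteq> (c ! j) s"
        then have "j = i \<and> (s = Loc \<or> s \<in> Var ` fst ` set (lt_assigns \<tau>))"
          unfolding local_step(1)
          using fold_set_slot_nth[of i c j s "lt_assigns \<tau>"] local_step(2) len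
          by (auto simp: set_slot_nth split: if_splits)
        then show "j \<noteq> d \<and> s \<in> skip_slot d ` slots S {..<N} \<and> (c ! d) s \<noteq> Up"
          using xs nU d(2) LocI VarI by auto
      qed
    qed auto
  next
    case (loop_start i t)
    show thesis
    proof (rule that[of "{i, 0}"])
      fix d assume d: "d < Suc N" "d \<notin> {i, 0}"
      obtain n where n: "n < N" "i = skip d n" using ex_skip[OF loop_start(2) d(1)] d(2) by auto
      \<comment> \<open>Since \<open>d\<close> is not 0, the first agent remains first, so the loop
        still starts at index 0.\<close>
      have z: "0 = skip d 0" using d(2) by (simp add: skip_def)
      note nU = configuration_not_Up[OF c d(1)]
      have P: "(c ! d) (Ptr i t) \<noteq> Up"
        using configuration_not_executing[OF c loop_start(2,3) _ d(1)] loop_start(4) by simp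
      show "projects S N d c c'"
      proof (rule projectsI)
        fix e assume "e < N"
        have "remove_agent S N d e c' = set_slot 0 (Ptr n t) Up
            (set_slot n Loc (Lp t) (remove_agent S N d e c))"
          unfolding loop_start(1)
          using rm(1)[of c N n d S e] rm(2)[of "set_slot i Loc (Lp t) c" N 0 n t S d e]
            n nU P len z loop_start by (simp add: set_slot_nth)
        then show "step S N (remove_agent S N d e c) (remove_agent S N d e c')"
          using step.loop_start[of n N t S "remove_agent S N d e c"] n loop_start nU
          by (simp add: remove_agent_nth)
      next
        fix j s assume "(c' ! j) s \<noteq> (c ! j) s"
        then show "j \<noteq> d \<and> s \<in> skip_slot d ` slots S {..<N} \<and> (c ! d) s \<noteq> Up"
          unfolding loop_start(1)
          using nU d(2) LocI PtrI[OF n(1) loop_start(3), of d] n(2) P loop_start(2) len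
          by (auto simp: set_slot_nth split: if_splits)
      qed
    qed (auto simp: card_insert_if)
  next
    case (loop_succ i t j)
    show thesis
    proof (rule that[of "{i, j}"])
      fix d assume d: "d < Suc N" "d \<notin> {i, j}"
      obtain n where n: "n < N" "i = skip d n" using ex_skip[OF loop_succ(2) d(1)] d(2) by auto
      obtain m where m: "m < N" "j = skip d m" using ex_skip[OF loop_succ(5) d(1)] d(2) by auto
      \<comment> \<open>Here \<open>j\<close> is the last of \<open>Suc N\<close> agents and
        \<open>d\<close> lies below it, so \<open>j\<close> becomes the last of \<open>N\<close>
        agents.\<close>
      have m': "m = N - 1" using m d loop_succ(8) by (auto simp: skip_def split: if_splits)
      note nU = configuration_not_Up[OF c d(1)]
      \<comment> \<open>The only pointer of \<open>i\<close> for \<open>t\<close> is at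
        \<open>j\<close>, which differs from \<open>d\<close>.\<close>
      have P: "(c ! d) (Ptr i t) \<noteq> Up"
        using configuration_Up_unique[OF c loop_succ(2,3,5,6) d(1)] d(2) by auto
      show "projects S N d c c'"
      proof (rule projectsI)
        fix e assume "e < N"
        have "remove_agent S N d e c' = set_slot m (Ptr n t) Box
            (set_slot n Loc (St (target_succ t)) (remove_agent S N d e c))"
          unfolding loop_succ(1)
          using rm(1)[of c N n d S e]
            rm(2)[of "set_slot i Loc (St (target_succ t)) c" N m n t S d e]
            n m nU P len loop_succ(2-5) by (simp add: set_slot_nth)
        then show "step S N (remove_agent S N d e c) (remove_agent S N d e c')"
          using step.loop_succ[of n N t S "remove_agent S N d e c" m] n m m' loop_succ(2-7) nU P
            holds_remove_agent[OF S c d(1) m(1) loop_succ(3), of e]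
          by (simp add: remove_agent_nth)
      next
        fix k s assume "(c' ! k) s \<noteq> (c ! k) s"
        then show "k \<noteq> d \<and> s \<in> skip_slot d ` slots S {..<N} \<and> (c ! d) s \<noteq> Up"
          unfolding loop_succ(1)
          using nU d(2) LocI PtrI[OF n(1) loop_succ(3), of d] n(2) P loop_succ(2,5) len
          by (auto simp: set_slot_nth split: if_splits)
      qed
    qed (auto simp: card_insert_if)
  next
    case (loop_next i t j)
    show thesis
    proof (rule that[of "{i, j, j + 1}"])
      fix d assume d: "d < Suc N" "d \<notin> {i, j, j + 1}"
      obtain n where n: "n < N" "i = skip d n" using ex_skip[OF loop_next(2) d(1)] d(2) by auto
      obtain m where m: "m < N" "j = skip d m" using ex_skip[OF loop_next(5) d(1)] d(2) by auto
      \<comment> \<open>As \<open>d\<close> is neither \<open>j\<close> nor \<open>j + 1\<close>,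
        these two agents stay adjacent, and the projected pointer is not yet at the last
        agent.\<close>
      have m': "m < N - 1" "Suc j = skip d (Suc m)"
        using m d loop_next(8) by (auto simp: skip_def split: if_splits)
      note nU = configuration_not_Up[OF c d(1)]
      have P: "(c ! d) (Ptr i t) \<noteq> Up"
        using configuration_Up_unique[OF c loop_next(2,3,5,6) d(1)] d(2) by auto
      show "projects S N d c c'"
      proof (rule projectsI)
        fix e assume "e < N"
        have "remove_agent S N d e c' = set_slot (m + 1) (Ptr n t) Up
            (set_slot m (Ptr n t) Box (remove_agent S N d e c))"
          unfolding loop_next(1)
          using rm(2)[of c N m n t S d e]
            rm(2)[of "set_slot j (Ptr i t) Box c" N "Suc m" n t S d e]
            n m m' P len loop_next(2-5) by (simp add: set_slot_nth)
        then show "step S N (remove_agent S N d e c) (remove_agent S N d e c')"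
          using step.loop_next[of n N t S "remove_agent S N d e c" m] n m m' loop_next(2-7) nU P
            holds_remove_agent[OF S c d(1) m(1) loop_next(3), of e]
          by (simp add: remove_agent_nth)
      next
        fix k s assume "(c' ! k) s \<noteq> (c ! k) s"
        then show "k \<noteq> d \<and> s \<in> skip_slot d ` slots S {..<N} \<and> (c ! d) s \<noteq> Up"
          unfolding loop_next(1)
          using d(2) PtrI[OF n(1) loop_next(3), of d] n(2) P loop_next(5,8) len
          by (auto simp: set_slot_nth split: if_splits)
      qed
    qed (use card3 in auto)
  next
    case (loop_fail i t j)
    show thesis
    proof (rule that[of "{i, j}"])
      fix d assume d: "d < Suc N" "d \<notin> {i, j}"
      obtain n where n: "n < N" "i = skip d n" using ex_skip[OF loop_fail(2) d(1)] d(2) by auto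
      obtain m where m: "m < N" "j = skip d m" using ex_skip[OF loop_fail(5) d(1)] d(2) by auto
      note nU = configuration_not_Up[OF c d(1)]
      have P: "(c ! d) (Ptr i t) \<noteq> Up"
        using configuration_Up_unique[OF c loop_fail(2,3,5,6) d(1)] d(2) by auto
      show "projects S N d c c'"
      proof (rule projectsI)
        fix e assume "e < N"
        have "remove_agent S N d e c' = set_slot m (Ptr n t) Box
            (set_slot n Loc (St (target_fail t)) (remove_agent S N d e c))"
          unfolding loop_fail(1)
          using rm(1)[of c N n d S e]
            rm(2)[of "set_slot i Loc (St (target_fail t)) c" N m n t S d e]
            n m nU P len loop_fail(2-5) by (simp add: set_slot_nth)
        then show "step S N (remove_agent S N d e c) (remove_agent S N d e c')"
          using step.loop_fail[of n N t S "remove_agent S N d e c" m] n m loop_fail(2-7) nU P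
            holds_remove_agent[OF S c d(1) m(1) loop_fail(3), of e]
          by (simp add: remove_agent_nth)
      next
        fix k s assume "(c' ! k) s \<noteq> (c ! k) s"
        then show "k \<noteq> d \<and> s \<in> skip_slot d ` slots S {..<N} \<and> (c ! d) s \<noteq> Up"
          unfolding loop_fail(1)
          using nU d(2) LocI PtrI[OF n(1) loop_fail(3), of d] n(2) P loop_fail(2,5) len
          by (auto simp: set_slot_nth split: if_splits)
      qed
    qed (auto simp: card_insert_if)
  qed
qed

section \<open>Associated powerwords and the transfer of intersections\<close>

lemma associated_powerword_nth:
  "j < length w \<Longrightarrow> s \<in> slots S {..<N} \<Longrightarrow>
   (associated_powerword S N w ! j) s = (case s of
        Loc \<Rightarrow> comp (w ! j) Loc
      | Var x \<Rightarrow> comp (w ! j) (Var x)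
      | Ptr i t \<Rightarrow> (case index (w ! i) of Some p \<Rightarrow> comp (w ! j) (Ptr p t) | None \<Rightarrow> {}))"
  by (simp add: associated_powerword_def)

text \<open>The position and the owner of a pointer slot are renumbered by the same map, so both the
  letter and the name looked up agree.\<close>

lemma associated_powerword_skip:
  assumes "length w = N" "length w' = Suc N" "\<And>n. n < N \<Longrightarrow> w' ! skip d n = w ! n"
    and "n < N" "s \<in> slots S {..<N}"
  shows "(associated_powerword S (Suc N) w' ! skip d n) (skip_slot d s)
       = (associated_powerword S N w ! n) s"
  using assms skip_slot_in_slots[OF assms(5), of d] skip_less_Suc[OF assms(4), of d]
  by (cases s) (simp_all add: associated_powerword_nth split: option.split)

lemma powerword_associated:
  assumes "length w = N" "\<forall>l \<in> set w. index l \<in> Some ` A \<union> {None}"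
    and "map comp w \<in> slotted_words (slots S A) (\<lambda>s. Pow (alphabet S s)) N"
  shows "powerword S N (associated_powerword S N w)"
proof -
  have *: "comp l s \<subseteq> alphabet S s" if "l \<in> set w" "s \<in> slots S A" for l s
    using assms(3) that unfolding slotted_words_def by (fastforce dest: PiE_mem)
  have "(associated_powerword S N w ! j) s \<subseteq> alphabet S s"
    if "j < N" "s \<in> slots S {..<N}" for j s
  proof (cases s)
    case (Ptr n t)
    then have n: "n < N" "t \<in> loop_transitions S" using that by auto
    then have "index (w ! n) \<in> Some ` A \<union> {None}" using assms(1,2) by simp
    then show ?thesis
      using Ptr that n *[of "w ! j" "Ptr (the (index (w ! n))) t"] assms(1)
      by (auto simp: associated_powerword_nth split: option.split)
  next
    case Loc
    then show ?thesis using that *[of "w ! j" Loc] assms(1) by (simp add: associated_powerword_nth)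
  next
    case (Var x)
    then show ?thesis
      using that *[of "w ! j" "Var x"] assms(1) by (simp add: associated_powerword_nth)
  qed
  moreover have "associated_powerword S N w ! j \<in> extensional (slots S {..<N})" if "j < N" for j
    using that assms(1) by (simp add: associated_powerword_def)
  ultimately have "associated_powerword S N w ! j \<in> (\<Pi>\<^sub>E s \<in> slots S {..<N}. Pow (alphabet S s))"
    if "j < N" for j
    using that by (simp add: PiE_iff)
  moreover have "length (associated_powerword S N w) = N"
    using assms(1) by (simp add: associated_powerword_def)
  ultimately show ?thesis
    unfolding powerword_def slotted_words_def mem_Collect_eq subset_iff in_set_conv_nth by metis
qed

text \<open>An intersection after removal pulls back to \<open>c\<close>. A witness that is a
  redirected pointer stems from \<open>d\<close>, where the powerword has the same letter as at
  \<open>skip d e\<close>; any other witness is found at its renumbered place.\<close>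

lemma intersects_remove_agentD:
  assumes len: "length w = N" "length w' = Suc N"
    and w': "\<And>n. n < N \<Longrightarrow> w' ! skip d n = w ! n"
    and de: "d < Suc N" "w' ! d = w' ! skip d e"
    and int: "intersects S N (remove_agent S N d e c) (associated_powerword S N w)"
  shows "intersects S (Suc N) c (associated_powerword S (Suc N) w')"
proof -
  let ?O = "associated_powerword S N w" and ?O' = "associated_powerword S (Suc N) w'"
  from int obtain n s where ns: "n < N" "s \<in> slots S {..<N}"
    "(remove_agent S N d e c ! n) s \<in> (?O ! n) s"
    by (auto simp: intersects_def)
  have s': "skip_slot d s \<in> slots S {..<Suc N}" using ns(2) by (rule skip_slot_in_slots)
  have O': "(?O' ! skip d n) (skip_slot d s) = (?O ! n) s"
    using associated_powerword_skip[OF len w' ns(1,2)] .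
  show ?thesis
  proof (cases "n = e \<and> (c ! d) (skip_slot d s) = Up")
    case True
    \<comment> \<open>A letter of the associated powerword depends on its position only through the
      letter of \<open>w'\<close> there.\<close>
    then have "?O' ! d = ?O' ! skip d n"
      using de skip_less_Suc[OF ns(1), of d] len(2)
      by (simp add: associated_powerword_def cong: option.case_cong)
    moreover have "(remove_agent S N d e c ! n) s = (c ! d) (skip_slot d s)"
      by (subst remove_agent_nth[OF ns(1,2)]) (simp add: True)
    ultimately have "(c ! d) (skip_slot d s) \<in> (?O' ! d) (skip_slot d s)"
      using ns(3) O' by simp
    then show ?thesis using de(1) s' unfolding intersects_def by blast
  next
    case False
    then have "(c ! skip d n) (skip_slot d s) \<in> (?O' ! skip d n) (skip_slot d s)"
      using ns(3) by (simp only: O' remove_agent_nth[OF ns(1,2)] if_False)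
    then show ?thesis using skip_less_Suc[OF ns(1)] s' unfolding intersects_def by blast
  qed
qed

section \<open>Inserting one more letter into the block\<close>

text \<open>The block of four equal letters is encoded by deletion: omitting any one of the
  positions \<open>i\<close> to \<open>i + 3\<close> from \<open>w'\<close> gives back
  \<open>w\<close>.\<close>

lemma trap_insert:
  assumes S: "parameterized_system S"
    and len: "length w = N" "length w' = Suc N"
    and i: "i + 2 < N"
    and w': "\<And>d n. i \<le> d \<Longrightarrow> d \<le> i + 3 \<Longrightarrow> n < N \<Longrightarrow> w' ! skip d n = w ! n"
    and trap: "trap S N (associated_powerword S N w)"
    and pw: "powerword S (Suc N) (associated_powerword S (Suc N) w')"
  shows "trap S (Suc N) (associated_powerword S (Suc N) w')"
  unfolding trap_def
proof (intro conjI allI impI)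
  let ?O = "associated_powerword S N w" and ?O' = "associated_powerword S (Suc N) w'"
  show "powerword S (Suc N) ?O'" by (rule pw)
  from trap have "intersects S N (init_config S N) ?O" by (simp add: trap_def)
  then obtain n s where ns: "n < N" "s \<in> slots S {..<N}"
    "(init_config S N ! n) s \<in> (?O ! n) s"
    by (auto simp: intersects_def)
  \<comment> \<open>The initial witness moves along \<open>skip i\<close>; any block position would
    serve as the omitted one.\<close>
  have "(?O' ! skip i n) (skip_slot i s) = (?O ! n) s"
    using associated_powerword_skip[OF len w' ns(1,2)] by simp
  moreover have "(init_config S (Suc N) ! skip i n) (skip_slot i s) = (init_config S N ! n) s"
    using ns skip_slot_in_slots[OF ns(2), of i] skip_less_Suc[OF ns(1), of i]
    by (cases s) (auto simp: init_config_def simp del: replicate.simps)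
  ultimately show "intersects S (Suc N) (init_config S (Suc N)) ?O'"
    using ns skip_slot_in_slots[OF ns(2), of i] skip_less_Suc[OF ns(1), of i]
    unfolding intersects_def by metis
next
  let ?O = "associated_powerword S N w" and ?O' = "associated_powerword S (Suc N) w'"
  fix c c'
  assume c: "configuration S (Suc N) c" and c': "configuration S (Suc N) c'"
    and step: "step S (Suc N) c c'" and int: "intersects S (Suc N) c ?O'"
  obtain F where F: "finite F" "card F \<le> 3"
    "\<And>d. d < Suc N \<Longrightarrow> d \<notin> F \<Longrightarrow> projects S N d c c'"
    using step_projects[OF S c step] by blast
  \<comment> \<open>Pigeonhole: four block positions against at most three touched agents.\<close>
  have "\<not> {i..i + 3} \<subseteq> F"
    using F(1,2) card_mono[of F "{i..i + 3}"] by auto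
  then obtain d where d: "i \<le> d" "d \<le> i + 3" "d \<notin> F" by (meson atLeastAtMost_iff subsetI)
  then have dN: "d < Suc N" using i by simp
  have e: "i < N" using i by simp
  have block: "w' ! d = w' ! skip d i"
  proof -
    \<comment> \<open>Omitting a block position other than \<open>d\<close> exhibits
      \<open>w' ! d\<close> as a letter of \<open>w\<close>. Below, one letter of \<open>w'\<close>
      is read with two different omissions, which identifies neighbouring letters of
      \<open>w\<close>.\<close>
    have "w' ! d = w ! i \<or> w' ! d = w ! (i + 1) \<or> w' ! d = w ! (i + 2)"
      using w'[of "if d = i then i + 1 else i" "if d = i then i else d - 1"] d i
      by (auto simp: skip_def le_Suc_eq numeral_3_eq_3 split: if_splits)
    moreover have "w ! i = w ! (i + 1)" "w ! (i + 1) = w ! (i + 2)"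
      using w'[of i i] w'[of "i + 2" "i + 1"] w'[of i "i + 1"] w'[of "i + 3" "i + 2"] i
      by (simp_all add: skip_def)
    ultimately show ?thesis using w'[OF d(1,2) e] by simp
  qed
  show "intersects S (Suc N) c' ?O'"
  proof (rule ccontr)
    assume no: "\<not> intersects S (Suc N) c' ?O'"
    obtain j s where js: "j < Suc N" "s \<in> slots S {..<Suc N}" "(c ! j) s \<in> (?O' ! j) s"
      using int by (auto simp: intersects_def)
    \<comment> \<open>An unchanged component would still witness an intersection with
      \<open>c'\<close>.\<close>
    have "(c' ! j) s \<noteq> (c ! j) s" using js no unfolding intersects_def by metis
    then obtain r where r: "j \<noteq> d" "r \<in> slots S {..<N}" "s = skip_slot d r" "(c ! d) s \<noteq> Up"
      using F(3)[OF dN d(3)] js unfolding projects_def by blast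
    obtain n where n: "n < N" "j = skip d n" using ex_skip[OF js(1) dN r(1)] .
    \<comment> \<open>The redirection target is \<open>e = i\<close>; in the larger instance this is
      \<open>skip d i\<close>, a block position different from \<open>d\<close>.\<close>
    have "(remove_agent S N d i c ! n) r \<in> (?O ! n) r"
      using js(3) r n associated_powerword_skip[OF len w'[OF d(1,2)] n(1) r(2)]
      by (simp add: remove_agent_nth)
    then have "intersects S N (remove_agent S N d i c) ?O"
      using n r(2) unfolding intersects_def by blast
    moreover have "step S N (remove_agent S N d i c) (remove_agent S N d i c')"
      using F(3)[OF dN d(3)] e by (simp add: projects_def)
    ultimately have "intersects S N (remove_agent S N d i c') ?O"
      using trap configuration_remove_agent[OF c dN e] configuration_remove_agent[OF c' dN e]
      unfolding trap_def by blast
    from intersects_remove_agentD[OF len w'[OF d(1,2)] dN block this] no show False by blast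
  qed
qed

lemma normalized_trap_insert:
  assumes S: "parameterized_system S"
    and w: "normalized_trap S A N w"
    and i: "i + 2 < N"
    and None: "index (w ! i) = None"
    and eq: "w ! i = w ! (i + 1)" "w ! (i + 1) = w ! (i + 2)"
  shows "normalized_trap S A (Suc N) (take i w @ w ! i # drop i w)" (is "normalized_trap _ _ _ ?w'")
proof -
  have len: "length w = N" using w unfolding normalized_trap_def by blast
  have len': "length ?w' = Suc N" using len i by simp
  have set: "set ?w' = set w"
  proof -
    have "set w = set (take i w) \<union> set (drop i w)"
      by (metis append_take_drop_id set_append)
    moreover have "w ! i \<in> set w" using i len by simp
    ultimately show ?thesis by auto
  qed
  have skip: "?w' ! skip d n = w ! n" if "i \<le> d" "d \<le> i + 3" "n < N" for d n
  proof -
    have before: "?w' ! m = w ! m" if "m \<le> i" for m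
      using that i len by (simp add: nth_append)
    have after: "?w' ! Suc m = w ! m" if "i \<le> m" for m
      using that i len by (simp add: nth_append Suc_diff_le)
    show ?thesis
    \<comment> \<open>Omitting \<open>d\<close> instead of the inserted position \<open>i\<close>
      matters only for indices strictly between them; there the word is read one place off, inside
      the run of equal letters.\<close>
    proof (cases "n < d \<and> i < n")
      case True
      with that(2) have "n = i + 1 \<or> n = i + 2" by auto
      then show ?thesis
        using True after[of i] after[of "i + 1"] eq by (auto simp: skip_def)
    next
      case False
      then show ?thesis using that(1) before[of n] after[of n] by (auto simp: skip_def)
    qed
  qed
  have skip_i: "?w' ! skip i n = w ! n" if "n < N" for n
    using skip[of i n] that by simp
  have w'_i: "index (?w' ! i) = None" using None i len by (simp add: nth_append)
  have idx: "\<forall>l \<in> set ?w'. index l \<in> Some ` A \<union> {None}"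
    using w unfolding normalized_trap_def set by blast
  have cmp: "map comp ?w' \<in> slotted_words (slots S A) (\<lambda>s. Pow (alphabet S s)) (Suc N)"
  proof -
    have "comp ` set w \<subseteq> (\<Pi>\<^sub>E s \<in> slots S A. Pow (alphabet S s))"
      using w unfolding normalized_trap_def slotted_words_def mem_Collect_eq set_map by blast
    then have "comp ` set ?w' \<subseteq> (\<Pi>\<^sub>E s \<in> slots S A. Pow (alphabet S s))"
      by (simp only: set)
    then show ?thesis using len' by (simp only: slotted_words_def mem_Collect_eq length_map set_map)
  qed
  have uniq: "\<exists>!j. j < Suc N \<and> index (?w' ! j) = Some p" if p: "p \<in> A" for p
  proof -
    have ex1: "\<exists>!n. n < N \<and> index (w ! n) = Some p"
      using w p by (simp only: normalized_trap_def)
    then obtain n where n: "n < N" "index (w ! n) = Some p" by (elim ex1E conjE)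
    have u: "m = n" if "m < N" "index (w ! m) = Some p" for m
      by (rule ex1E[OF ex1]) (use that n in metis)
    show ?thesis
    proof (rule ex1I[of _ "skip i n"])
      show "skip i n < Suc N \<and> index (?w' ! skip i n) = Some p"
        using n skip_i skip_less_Suc by simp
    next
      fix j assume j: "j < Suc N \<and> index (?w' ! j) = Some p"
      \<comment> \<open>The inserted copy is nameless, so every named agent is in the range of
        \<open>skip i\<close> and no name is duplicated.\<close>
      then have "j \<noteq> i" using w'_i by (metis option.distinct(1))
      moreover have "i < Suc N" using i by simp
      ultimately obtain m where m: "m < N" "j = skip i m" using ex_skip[of j N i] j by metis
      then show "j = skip i n" using u[of m] j skip_i[OF m(1)] by simp
    qed
  qed
  have up: "\<exists>k < Suc N. comp (?w' ! k) (Ptr p t) = {Up}"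
    if p: "p \<in> A" "t \<in> loop_transitions S" for p t
  proof -
    obtain k where "k < N" "comp (w ! k) (Ptr p t) = {Up}"
      using w p unfolding normalized_trap_def by blast
    then show ?thesis using skip_i skip_less_Suc by (intro exI[of _ "skip i k"]) simp
  qed
  have "trap S N (associated_powerword S N w)"
    using w unfolding normalized_trap_def by blast
  then have "trap S (Suc N) (associated_powerword S (Suc N) ?w')"
    using trap_insert[OF S len len' i skip] powerword_associated[OF len' idx cmp] by blast
  then show ?thesis
    unfolding normalized_trap_def using len' idx cmp uniq up by blast
qed

section \<open>Pumping the block by induction on the number of copies\<close>

theorem theorem1:
  fixes S :: "('q, 'x, 'v) system"
    and A :: "'p set"
    and w :: "('p, 'q, 'x, 'v) norm_letter list"
    and N i k :: nat
  assumes "parameterized_system S"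
    and "finite A"
    and "normalized_trap S A N w"
    and "i + 2 \<le> N - 1"
    and "index (w ! i) = None"
    and "w ! i = w ! (i + 1)"
    and "w ! (i + 1) = w ! (i + 2)"
    and "k \<ge> 1"
  shows "normalized_trap S A (N + k - 1) (take i w @ replicate k (w ! i) @ drop (i + 1) w)"
  using \<open>k \<ge> 1\<close>
proof (induction k rule: dec_induct)
  case base
  have "length w = N" using assms(3) unfolding normalized_trap_def by blast
  then show ?case using assms(3,4) by (simp add: id_take_nth_drop[symmetric])
next
  case (step k)
  let ?v = "take i w @ replicate k (w ! i) @ drop (i + 1) w"
  have len: "length w = N" using assms(3) unfolding normalized_trap_def by blast
  \<comment> \<open>The \<open>k\<close> copies are followed by \<open>w ! (i + 1)\<close> and
    \<open>w ! (i + 2)\<close>, so at least three equal letters start at \<open>i\<close>, as one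
    more insertion requires. For \<open>m >= k\<close> the position falls on one of these two
    trailing letters.\<close>
  have v: "?v ! (i + m) = w ! i" if "m \<le> 2" for m
  proof (cases "m < k")
    case True
    then show ?thesis using len assms(4) by (simp add: nth_append)
  next
    case False
    with that step(1) have "m = 1 \<and> k = 1 \<or> m = 2 \<and> k = 1 \<or> m = 2 \<and> k = 2" by auto
    then show ?thesis using len assms(4,6,7) by (auto simp: nth_append)
  qed
  have "normalized_trap S A (Suc (N + k - 1)) (take i ?v @ ?v ! i # drop i ?v)"
    using v[of 0] v[of 1] v[of 2] assms(1,4,5) step
    by (intro normalized_trap_insert) auto
  moreover have "take i ?v @ ?v ! i # drop i ?v
      = take i w @ replicate (Suc k) (w ! i) @ drop (i + 1) w"
    using v[of 0] len assms(4) by simp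
  moreover have "Suc (N + k - 1) = N + Suc k - 1" using step(1) by simp
  ultimately show ?case by simp
qed

end
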